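(* Let $(f_E,\tau)$ be a fuzzy soft topological space and let $g_A$ be any fuzzy soft set in it. Then the following are equivalent: (1) $g_A$ is a semiclosed fuzzy soft set; (2) $int(cl(g_A))\,\widetilde{\subseteq}\, g_A$; (3) $cl(int(g_A^c))\,\widetilde{\supseteq}\, g_A^c$; (4) $g_A^c$ is a semiopen fuzzy soft set.
   Context: Let $U$ be a universe and $E$ a set of parameters. A fuzzy soft set $g_A$ over $U$ (with $A\subseteq E$) is a map $g$ assigning to each parameter $e\in E$ a fuzzy set $g(e):U\to[0,1]$, with $g(e)$ the zero fuzzy set for $e\notin A$. Inclusion $\widetilde{\subseteq}$, union $\widetilde{\bigcup}$ and intersection $\widetilde{\bigcap}$ are defined pointwise (by $\le$, supremum and infimum of membership values, for each parameter $e$ and each element of $U$). $\widetilde{\Phi}_E$ is the fuzzy soft set all of whose values are the zero fuzzy set. Fix a fuzzy soft set $f_E$. All fuzzy soft sets considered are fuzzy soft subsets of $f_E$ (i.e. $g_A\,\widetilde{\subseteq}\, f_E$). The complement $g_A^c$ of $g_A$ is taken relative to $f_E$: $g^c(e)(x)=f(e)(x)-g(e)(x)$. A fuzzy soft topology on $f_E$ is a family $\tau$ of fuzzy soft subsets of $f_E$ containing $\widetilde{\Phi}_E$ and $f_E$ and closed under intersections of two members and arbitrary unions; $(f_E,\tau)$ is then a fuzzy soft topological space. Members of $\tau$ are called open fuzzy soft sets and their complements closed fuzzy soft sets. The closure $cl(g_A)$ is the intersection of all closed fuzzy soft sets containing $g_A$; the interior $int(g_A)$ is the union of all open fuzzy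 soft sets contained in $g_A$. A fuzzy soft set $g_A$ is semiopen if there is an open fuzzy soft set $h_A$ with $h_A\,\widetilde{\subseteq}\, g_A\,\widetilde{\subseteq}\, cl(h_A)$. A fuzzy soft set $p_A$ is semiclosed if there is a closed fuzzy soft set $k_A$ with $int(k_A)\,\widetilde{\subseteq}\, p_A\,\widetilde{\subseteq}\, k_A$. *)

theory Defs
  imports Complex_Main
begin

text \<open>
  A fuzzy soft set over the universe \<open>U\<close> is encoded as a total function taking a parameter and
  a point to a membership value. To make equality of fuzzy soft sets agree with
  equality of functions, values at points outside \<open>U\<close> are fixed to be \<open>0\<close>, as are those
  at parameters outside \<open>A\<close>. Inclusion, binary intersection and the null fuzzy soft set are then the
  pointwise \<open>\<le>\<close>, \<open>inf\<close> and \<open>0\<close> on functions.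
\<close>

type_synonym ('e, 'u) fss = "'e \<Rightarrow> 'u \<Rightarrow> real"

definition fuzzy_soft_set :: "'u set \<Rightarrow> 'e set \<Rightarrow> 'e set \<Rightarrow> ('e, 'u) fss \<Rightarrow> bool" where
  "fuzzy_soft_set U E A g \<longleftrightarrow>
     A \<subseteq> E \<and>
     (\<forall>e\<in>E. \<forall>x\<in>U. 0 \<le> g e x \<and> g e x \<le> 1) \<and>
     (\<forall>e x. e \<notin> A \<or> x \<notin> U \<longrightarrow> g e x = 0)"

definition fss_subsets :: "'u set \<Rightarrow> 'e set \<Rightarrow> ('e, 'u) fss \<Rightarrow> ('e, 'u) fss set" where
  "fss_subsets U E f = {g. (\<exists>A. fuzzy_soft_set U E A g) \<and> g \<le> f}"

definition fss_null :: "('e, 'u) fss" where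
  "fss_null = (\<lambda>e x. 0)"

definition fss_compl :: "('e, 'u) fss \<Rightarrow> ('e, 'u) fss \<Rightarrow> ('e, 'u) fss" where
  "fss_compl f g = (\<lambda>e x. f e x - g e x)"

text \<open>
  Suprema of membership values are taken in \<open>[0,1]\<close>, so that the union of the empty family is the
  null fuzzy soft set; inserting \<open>0\<close> does not change the supremum for nonempty families.
\<close>

definition fss_Union :: "('e, 'u) fss set \<Rightarrow> ('e, 'u) fss" where
  "fss_Union F = (\<lambda>e x. Sup (insert 0 ((\<lambda>g. g e x) ` F)))"

text \<open>
  Meaningful for nonempty families only. The family defining the closure of a fuzzy
  soft subset of \<open>f\<close> always contains \<open>f\<close>.
\<close>

definition fss_Inter :: "('e, 'u) fss set \<Rightarrow> ('e, 'u) fss" where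
  "fss_Inter F = (\<lambda>e x. Inf ((\<lambda>g. g e x) ` F))"

definition fuzzy_soft_topology ::
    "'u set \<Rightarrow> 'e set \<Rightarrow> ('e, 'u) fss \<Rightarrow> ('e, 'u) fss set \<Rightarrow> bool" where
  "fuzzy_soft_topology U E f \<tau> \<longleftrightarrow>
     fuzzy_soft_set U E E f \<and>
     \<tau> \<subseteq> fss_subsets U E f \<and>
     fss_null \<in> \<tau> \<and> f \<in> \<tau> \<and>
     (\<forall>g\<in>\<tau>. \<forall>h\<in>\<tau>. inf g h \<in> \<tau>) \<and>
     (\<forall>F. F \<subseteq> \<tau> \<longrightarrow> fss_Union F \<in> \<tau>)"

definition fss_closed_sets :: "('e, 'u) fss \<Rightarrow> ('e, 'u) fss set \<Rightarrow> ('e, 'u) fss set" where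
  "fss_closed_sets f \<tau> = fss_compl f ` \<tau>"

definition fss_cl :: "('e, 'u) fss \<Rightarrow> ('e, 'u) fss set \<Rightarrow> ('e, 'u) fss \<Rightarrow> ('e, 'u) fss" where
  "fss_cl f \<tau> g = fss_Inter {k \<in> fss_closed_sets f \<tau>. g \<le> k}"

definition fss_int :: "('e, 'u) fss set \<Rightarrow> ('e, 'u) fss \<Rightarrow> ('e, 'u) fss" where
  "fss_int \<tau> g = fss_Union {h \<in> \<tau>. h \<le> g}"

text \<open>
  In the next two definitions the bounds force the set in question to be a
  fuzzy soft subset of \<open>f\<close> when \<open>\<tau>\<close> is a fuzzy soft topology on \<open>f\<close>. The witness
  is not required to vanish outside the parameter set \<open>A\<close> of the given fuzzy soft set.
\<close>

definition fss_semiopen ::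
    "('e, 'u) fss \<Rightarrow> ('e, 'u) fss set \<Rightarrow> ('e, 'u) fss \<Rightarrow> bool" where
  "fss_semiopen f \<tau> g \<longleftrightarrow> (\<exists>h\<in>\<tau>. h \<le> g \<and> g \<le> fss_cl f \<tau> h)"

definition fss_semiclosed ::
    "('e, 'u) fss \<Rightarrow> ('e, 'u) fss set \<Rightarrow> ('e, 'u) fss \<Rightarrow> bool" where
  "fss_semiclosed f \<tau> p \<longleftrightarrow> (\<exists>k\<in>fss_closed_sets f \<tau>. fss_int \<tau> k \<le> p \<and> p \<le> k)"

end

theory Submission
  imports Defs
begin

text \<open>
  As in ordinary topology, complementation exchanges closure and interior:
  \<open>cl g = (int g\<^sup>c)\<^sup>c\<close> (lemma \<open>fss_cl_eq_compl_int_compl\<close>). A fuzzy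
  set and its complement may overlap, so the argument is order-theoretic:
  \<open>g \<mapsto> f - g\<close> is an order-reversing involution, and the interior of \<open>g\<close> is the greatest
  open set below \<open>g\<close>.

  So \<open>int (cl g)\<close> and \<open>cl (int g\<^sup>c)\<close> are complements of each other, which makes the inclusions
  \<open>int (cl g) \<le> g\<close> and \<open>g\<^sup>c \<le> cl (int g\<^sup>c)\<close> equivalent
  (\<open>int_cl_le_iff_compl_le_cl_int_compl\<close>), and the same duality matches semiclosed sets with
  complements of semiopen ones (\<open>fss_semiclosed_iff_semiopen_compl\<close>). What links the two pairs is
  that \<open>int g\<^sup>c\<close>, as the greatest open set below \<open>g\<^sup>c\<close>, is the best possible witness for \<open>g\<^sup>c\<close>
  to be semiopen (\<open>fss_semiopen_iff_le_cl_int\<close>).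
\<close>

lemma fss_compl_fss_compl [simp]: "fss_compl f (fss_compl f g) = g"
  by (simp add: fss_compl_def)

lemma fss_compl_le_fss_compl_iff [simp]: "fss_compl f g \<le> fss_compl f h \<longleftrightarrow> h \<le> g"
  by (simp add: fss_compl_def le_fun_def)

lemma le_fss_compl_swap: "h \<le> fss_compl f g \<longleftrightarrow> g \<le> fss_compl f h"
  using fss_compl_le_fss_compl_iff[of f "fss_compl f h" g] by simp

lemma fss_null_le_fss_compl_iff: "fss_null \<le> fss_compl f g \<longleftrightarrow> g \<le> f"
  by (simp add: fss_null_def fss_compl_def le_fun_def)

lemma open_fss_le:
  assumes "fuzzy_soft_topology U E f \<tau>" and "h \<in> \<tau>"
  shows "h \<le> f"
  using assms unfolding fuzzy_soft_topology_def fss_subsets_def by auto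

lemma fss_int_open:
  assumes "fuzzy_soft_topology U E f \<tau>"
  shows "fss_int \<tau> g \<in> \<tau>"
  using assms unfolding fuzzy_soft_topology_def fss_int_def by auto

text \<open>
  The supremum defining the interior always includes the value \<open>0\<close>, so the interior can lie
  below \<open>g\<close> only if \<open>g\<close> is nonnegative.
\<close>

lemma fss_int_le:
  assumes "fss_null \<le> g"
  shows "fss_int \<tau> g \<le> g"
proof (intro le_funI)
  fix e x
  show "fss_int \<tau> g e x \<le> g e x"
    unfolding fss_int_def fss_Union_def
    using assms by (intro cSup_least) (auto simp: le_fun_def fss_null_def)
qed

text \<open>
  The real supremum is meaningful only for bounded sets; here the membership values of all sets
  below \<open>g\<close> are bounded by \<open>max 0 (g e x)\<close>.
\<close>

lemma le_fss_int:
  assumes "h \<in> \<tau>" and "h \<le> g"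
  shows "h \<le> fss_int \<tau> g"
proof (intro le_funI)
  fix e x
  have "bdd_above (insert 0 ((\<lambda>h. h e x) ` {h \<in> \<tau>. h \<le> g}))"
    by (rule bdd_aboveI[of _ "max 0 (g e x)"]) (auto simp: le_fun_def intro: max.coboundedI2)
  then show "h e x \<le> fss_int \<tau> g e x"
    unfolding fss_int_def fss_Union_def using assms by (intro cSup_upper) auto
qed

lemma fss_int_mono:
  assumes "fuzzy_soft_topology U E f \<tau>" and "fss_null \<le> g" and "g \<le> g'"
  shows "fss_int \<tau> g \<le> fss_int \<tau> g'"
  using le_fss_int[OF fss_int_open[OF assms(1)]] order_trans[OF fss_int_le[OF assms(2)] assms(3)]
  by blast

text \<open>
  The closed sets above \<open>g\<close> are exactly the complements of the open sets below \<open>g\<^sup>c\<close>, and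
  \<open>t \<mapsto> f e x - t\<close> turns suprema into infima. The null set is
  one of these open sets because \<open>g \<le> f\<close>; hence the infimum is over a nonempty set and matches the
  supremum with \<open>0\<close> inserted.
\<close>

lemma fss_cl_eq_compl_int_compl:
  assumes top: "fuzzy_soft_topology U E f \<tau>" and "g \<le> f"
  shows "fss_cl f \<tau> g = fss_compl f (fss_int \<tau> (fss_compl f g))"
proof (intro ext)
  fix e x
  let ?O = "{h \<in> \<tau>. h \<le> fss_compl f g}"
  have closed: "{k \<in> fss_closed_sets f \<tau>. g \<le> k} = fss_compl f ` ?O"
    unfolding fss_closed_sets_def using le_fss_compl_swap[of _ f g] by auto
  have null: "fss_null \<in> ?O"
    using assms fss_null_le_fss_compl_iff[of f g] unfolding fuzzy_soft_topology_def by auto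
  have "Inf ((\<lambda>k. k e x) ` fss_compl f ` ?O) = f e x - fss_int \<tau> (fss_compl f g) e x"
  proof (rule cInf_eq_non_empty)
    show "(\<lambda>k. k e x) ` fss_compl f ` ?O \<noteq> {}"
      using null by blast
  next
    fix t assume "t \<in> (\<lambda>k. k e x) ` fss_compl f ` ?O"
    then obtain h where "h \<in> ?O" and "t = f e x - h e x"
      by (auto simp: fss_compl_def)
    then show "f e x - fss_int \<tau> (fss_compl f g) e x \<le> t"
      using le_fss_int[of h \<tau> "fss_compl f g"] by (auto simp: le_fun_def)
  next
    \<comment> \<open>The interior is itself an open set below \<open>g\<^sup>c\<close>, so the infimum is attained.\<close>
    fix b assume lower: "\<And>t. t \<in> (\<lambda>k. k e x) ` fss_compl f ` ?O \<Longrightarrow> b \<le> t"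
    have "fss_int \<tau> (fss_compl f g) \<in> ?O"
      using fss_int_open[OF top] fss_int_le null by auto
    then have "b \<le> fss_compl f (fss_int \<tau> (fss_compl f g)) e x"
      by (intro lower imageI)
    then show "b \<le> f e x - fss_int \<tau> (fss_compl f g) e x"
      by (simp add: fss_compl_def)
  qed
  then show "fss_cl f \<tau> g e x = fss_compl f (fss_int \<tau> (fss_compl f g)) e x"
    unfolding fss_cl_def fss_Inter_def closed by (simp add: fss_compl_def)
qed

text \<open>
  A closed set \<open>k\<close> witnesses that \<open>g\<close> is semiclosed exactly when the open set \<open>k\<^sup>c\<close>
  witnesses that \<open>g\<^sup>c\<close> is semiopen: complementing \<open>int k \<le> g\<close> gives \<open>g\<^sup>c \<le> cl (k\<^sup>c)\<close>.
\<close>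

lemma fss_semiclosed_iff_semiopen_compl:
  assumes top: "fuzzy_soft_topology U E f \<tau>"
  shows "fss_semiclosed f \<tau> g \<longleftrightarrow> fss_semiopen f \<tau> (fss_compl f g)"
proof -
  have "fss_int \<tau> (fss_compl f h) \<le> g \<longleftrightarrow> fss_compl f g \<le> fss_cl f \<tau> h" if "h \<in> \<tau>" for h
    using fss_cl_eq_compl_int_compl[OF top open_fss_le[OF top that]] by simp
  then show ?thesis
    unfolding fss_semiclosed_def fss_semiopen_def fss_closed_sets_def
    using le_fss_compl_swap[of _ f g] by auto
qed

text \<open>
  Any open witness \<open>h\<close> lies below \<open>int g\<close>, hence \<open>cl h \<le> cl (int g)\<close>; so \<open>int g\<close> is a
  witness whenever there is one.
\<close>

lemma fss_semiopen_iff_le_cl_int: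
  assumes top: "fuzzy_soft_topology U E f \<tau>" and "fss_null \<le> g"
  shows "fss_semiopen f \<tau> g \<longleftrightarrow> g \<le> fss_cl f \<tau> (fss_int \<tau> g)"
proof
  assume "fss_semiopen f \<tau> g"
  then obtain h where h: "h \<in> \<tau>" "h \<le> g" "g \<le> fss_cl f \<tau> h"
    unfolding fss_semiopen_def by blast
  have bounds: "h \<le> f" "fss_int \<tau> g \<le> f"
    using open_fss_le[OF top] h(1) fss_int_open[OF top] by auto
  have "fss_int \<tau> (fss_compl f (fss_int \<tau> g)) \<le> fss_int \<tau> (fss_compl f h)"
    using le_fss_int[OF h(1,2)] bounds
    by (intro fss_int_mono[OF top]) (simp_all add: fss_null_le_fss_compl_iff)
  then have "fss_cl f \<tau> h \<le> fss_cl f \<tau> (fss_int \<tau> g)"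
    using bounds by (simp add: fss_cl_eq_compl_int_compl[OF top])
  with h(3) show "g \<le> fss_cl f \<tau> (fss_int \<tau> g)" by (rule order_trans)
next
  assume "g \<le> fss_cl f \<tau> (fss_int \<tau> g)"
  then show "fss_semiopen f \<tau> g"
    unfolding fss_semiopen_def using fss_int_open[OF top] fss_int_le[OF assms(2)] by blast
qed

lemma int_cl_le_iff_compl_le_cl_int_compl:
  assumes top: "fuzzy_soft_topology U E f \<tau>" and "g \<le> f"
  shows "fss_int \<tau> (fss_cl f \<tau> g) \<le> g \<longleftrightarrow>
    fss_compl f g \<le> fss_cl f \<tau> (fss_int \<tau> (fss_compl f g))"
  using fss_cl_eq_compl_int_compl[OF top \<open>g \<le> f\<close>]
    fss_cl_eq_compl_int_compl[OF top open_fss_le[OF top fss_int_open[OF top]]]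
  by simp

theorem theorem2p12:
  fixes U :: "'u set" and E A :: "'e set"
    and f g :: "('e, 'u) fss" and \<tau> :: "('e, 'u) fss set"
  assumes "fuzzy_soft_topology U E f \<tau>"
    and "fuzzy_soft_set U E A g" and "g \<le> f"
  shows "(fss_semiclosed f \<tau> g \<longleftrightarrow> fss_int \<tau> (fss_cl f \<tau> g) \<le> g) \<and>
         (fss_int \<tau> (fss_cl f \<tau> g) \<le> g \<longleftrightarrow>
            fss_compl f g \<le> fss_cl f \<tau> (fss_int \<tau> (fss_compl f g))) \<and>
         (fss_compl f g \<le> fss_cl f \<tau> (fss_int \<tau> (fss_compl f g)) \<longleftrightarrow>
            fss_semiopen f \<tau> (fss_compl f g))"
  using fss_semiclosed_iff_semiopen_compl[OF assms(1), of g]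
    fss_semiopen_iff_le_cl_int[OF assms(1), of "fss_compl f g"]
    int_cl_le_iff_compl_le_cl_int_compl[OF assms(1,3)]
    fss_null_le_fss_compl_iff[of f g] assms(3)
  by blast

end
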